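(* Let $G$ be a bipartite graph with vertex classes $V=\{v_1,\ldots,v_n\}$ and $W=\{w_1,\ldots,w_n\}$. Denote $d_i=\deg(v_i)$ and $D_i=\deg(w_i)$ for $i=1,2,\ldots,n$. Assume that $1\le d_1\le d_2\le\cdots\le d_n$ and $1\le D_1\le D_2\le\cdots\le D_n$. Let $\ell:=\min\{i:\ d_i>1\}$, with the convention that $\ell=n+1$ if all $d_i$ are equal to $1$. Then $$|\mathcal M_{\mathrm{perf}}(G)|\le \prod_{i=\ell}^{p}(d_i!)^{\frac{1}{d_i-1}}\ \prod_{i=p+1}^{n-1}(d_i!)^{\frac{1}{d_i}},$$ where $p=\min\{D_n+\ell-2,\ n-1\}$.
   Context: A perfect matching of a graph $G=(V(G),E(G))$ is a subset $\sigma\subseteq E(G)$ such that every vertex of $G$ is incident with exactly one edge of $\sigma$; $\mathcal M_{\mathrm{perf}}(G)$ denotes the set of all perfect matchings of $G$. An empty product (upper index smaller than lower index) is interpreted as $1$. In the situation that $d_i=1$ for all $1\le i\le n$, $\ell$ is interpreted as $n+1$ and the asserted bound is $1$. *)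

theory Defs
  imports Complex_Main
begin

text \<open>A simple graph is given by its vertex set \<open>V\<close> and its set \<open>E\<close> of edges, an edge being
  the set of its two endpoints. The vertex classes are disjoint and the edge with endpoints \<open>a\<close>, \<open>b\<close> is
  \<open>{a, b}\<close>, so that neither loops nor parallel edges occur.\<close>

definition bipartite_graph :: "'a set \<Rightarrow> 'a set set \<Rightarrow> 'a set \<Rightarrow> 'a set \<Rightarrow> bool" where
  "bipartite_graph V E A B \<longleftrightarrow>
     V = A \<union> B \<and> A \<inter> B = {} \<and> (\<forall>e\<in>E. \<exists>a\<in>A. \<exists>b\<in>B. e = {a, b})"

definition vertex_degree :: "'a set set \<Rightarrow> 'a \<Rightarrow> nat" where
  "vertex_degree E x = card {e \<in> E. x \<in> e}"

definition perfect_matchings :: "'a set \<Rightarrow> 'a set set \<Rightarrow> 'a set set set" where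
  "perfect_matchings V E = {\<sigma>. \<sigma> \<subseteq> E \<and> (\<forall>x\<in>V. \<exists>!e. e \<in> \<sigma> \<and> x \<in> e)}"

end

theory Submission
  imports Defs "HOL-Combinatorics.Multiset_Permutations"
begin

text \<open>The proof sharpens the entropy proof of Bregman's theorem by a random order of the vertices that always ends
with the vertex \<open>v n\<close> of largest degree.

Fix an order of the vertices \<open>v 1, \<dots>, v (n - 1)\<close> and match them one after the other, each with a uniformly
random neighbour that is still free. The probabilities of producing the different perfect matchings
\<open>\<sigma>\<close> add up to at most \<open>1\<close> (\<open>sum_prod_inverse_choices_le_1\<close>), and each is a product of reciprocals
of numbers of free neighbours. Gibbs' inequality (\<open>card_ln_card_le\<close>) then bounds the logarithm of the number of perfect
matchings by the mean, over all \<open>\<sigma>\<close>, of the sum of the logarithms of these numbers. The last vertex \<open>v n\<close>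
does not enter, as its partner is determined by the others.

This holds for every order, hence on average over all orders. For fixed \<open>\<sigma>\<close> and \<open>i\<close>, the
number of free neighbours of \<open>v i\<close> is determined by its rank among the vertices other than \<open>v n\<close> that \<open>\<sigma>\<close> matches with neighbours
of \<open>v i\<close>, and this rank is uniformly distributed (\<open>rank_uniform\<close>). If the partner of \<open>v n\<close> is no neighbour of
\<open>v i\<close>, the mean logarithm is Bregman's \<open>ln d! / d\<close>, where \<open>d\<close> is the degree of \<open>v i\<close>. If it is one, it stays free to the
end, and the mean is \<open>ln d! / (d - 1)\<close> (\<open>sum_ln_choices\<close>).

The second case occurs for at most \<open>D n - 1\<close> vertices, all of degree at least \<open>2\<close>. It costs the difference
\<open>ln d! / (d * (d - 1))\<close>, which decreases with \<open>d\<close> (\<open>log_gain_antimono\<close>). Therefore the bound is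
largest if it occurs for the first \<open>D n - 1\<close> vertices of degree at least \<open>2\<close>, that is, for the
indices \<open>l, \<dots>, p\<close>.\<close>

section \<open>A random greedy choice\<close>

text \<open>The family \<open>F\<close> is a set of possible outcomes of a random process that visits the indices in the
order \<open>xs\<close> and gives each of them a uniformly random element of \<open>N i\<close> that is neither in \<open>U\<close> nor
already taken. The product is the probability that the process produces \<open>\<sigma>\<close>, and since \<open>\<sigma>\<close> is
determined by its values on \<open>xs\<close>, these events are disjoint. The set \<open>U\<close> of elements that were taken
earlier makes the induction on \<open>xs\<close> work.\<close>

lemma sum_prod_inverse_choices_le_1:
  fixes N :: "'i \<Rightarrow> 'b set" and U :: "'b set" and F :: "('i \<Rightarrow> 'b) set"
  assumes "finite F" "distinct xs" "\<And>i. i \<in> set xs \<Longrightarrow> finite (N i)"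
    and "\<And>\<sigma> i. \<sigma> \<in> F \<Longrightarrow> i \<in> set xs \<Longrightarrow> \<sigma> i \<in> N i"
    and "\<And>\<sigma>. \<sigma> \<in> F \<Longrightarrow> inj_on \<sigma> (set xs)"
    and "\<And>\<sigma>. \<sigma> \<in> F \<Longrightarrow> \<sigma> ` set xs \<inter> U = {}"
    and "inj_on (\<lambda>\<sigma>. restrict \<sigma> (set xs)) F"
  shows "(\<Sum>\<sigma>\<in>F. \<Prod>i\<in>set xs. 1 / real (card (N i - (U \<union> \<sigma> ` set (takeWhile (\<lambda>j. j \<noteq> i) xs))))) \<le> 1"
  using assms
proof (induction xs arbitrary: U F)
  case Nil
  have "\<sigma> = \<tau>" if "\<sigma> \<in> F" "\<tau> \<in> F" for \<sigma> \<tau>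
    using Nil.prems(7) that by (auto simp: inj_on_def)
  then have "card F \<le> 1"
    using Nil.prems(1) by (simp add: card_le_Suc0_iff_eq)
  then show ?case by simp
next
  case (Cons x xs)
  define q where "q U \<sigma> xs = (\<Prod>i\<in>set xs. 1 / real (card (N i - (U \<union> \<sigma> ` set (takeWhile (\<lambda>j. j \<noteq> i) xs)))))"
    for U and \<sigma> :: "'i \<Rightarrow> 'b" and xs
  define C where "C = N x - U"
  have finC: "finite C" using Cons.prems(3) by (simp add: C_def)
  have q_Cons: "q U \<sigma> (x # xs) = 1 / real (card C) * q (insert (\<sigma> x) U) \<sigma> xs" for \<sigma>
  proof -
    have "x \<notin> set xs" using Cons.prems(2) by simp
    moreover from this have
      "(\<Prod>i\<in>set xs. 1 / real (card (N i - (U \<union> \<sigma> ` set (takeWhile (\<lambda>j. j \<noteq> i) (x # xs))))))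
        = q (insert (\<sigma> x) U) \<sigma> xs"
      unfolding q_def
    proof (intro prod.cong refl)
      fix i assume "i \<in> set xs"
      then have "x \<noteq> i" using \<open>x \<notin> set xs\<close> by blast
      then show "1 / real (card (N i - (U \<union> \<sigma> ` set (takeWhile (\<lambda>j. j \<noteq> i) (x # xs)))))
          = 1 / real (card (N i - (insert (\<sigma> x) U \<union> \<sigma> ` set (takeWhile (\<lambda>j. j \<noteq> i) xs))))"
        by simp
    qed
    ultimately show ?thesis
      by (simp add: q_def C_def)
  qed
  have inC: "\<sigma> x \<in> C" if "\<sigma> \<in> F" for \<sigma>
    using Cons.prems(4)[OF that] Cons.prems(6)[OF that] by (auto simp: C_def)
  \<comment> \<open>The first choice \<open>y\<close> is uniform in \<open>C\<close>; what follows it has total probability at most \<open>1\<close>.\<close>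
  have "(\<Sum>\<sigma>\<in>F. q U \<sigma> (x # xs)) = (\<Sum>y\<in>C. \<Sum>\<sigma>\<in>{\<sigma>\<in>F. \<sigma> x = y}. q U \<sigma> (x # xs))"
    using Cons.prems(1) finC inC by (intro sum.group[symmetric]) auto
  also have "\<dots> \<le> (\<Sum>y\<in>C. 1 / real (card C))"
  proof (rule sum_mono)
    fix y assume "y \<in> C"
    have "(\<Sum>\<sigma>\<in>{\<sigma>\<in>F. \<sigma> x = y}. q (insert y U) \<sigma> xs) \<le> 1"
      unfolding q_def
    proof (rule Cons.IH)
      show "\<sigma> ` set xs \<inter> insert y U = {}" if "\<sigma> \<in> {\<sigma>\<in>F. \<sigma> x = y}" for \<sigma>
      proof -
        have "\<sigma> x = y" "\<sigma> \<in> F" "x \<notin> set xs"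
          using that Cons.prems(2) by auto
        moreover have "inj_on \<sigma> (set (x # xs))"
          using \<open>\<sigma> \<in> F\<close> by (rule Cons.prems(5))
        ultimately have "y \<notin> \<sigma> ` set xs"
          by (auto simp: inj_on_def)
        then show ?thesis
          using Cons.prems(6)[of \<sigma>] that by auto
      qed
      show "inj_on (\<lambda>\<sigma>. restrict \<sigma> (set xs)) {\<sigma>\<in>F. \<sigma> x = y}"
      proof (rule inj_onI)
        fix \<sigma> \<tau> assume a: "\<sigma> \<in> {\<sigma>\<in>F. \<sigma> x = y}" "\<tau> \<in> {\<sigma>\<in>F. \<sigma> x = y}"
          "restrict \<sigma> (set xs) = restrict \<tau> (set xs)"
        have "\<sigma> i = \<tau> i" if "i \<in> set xs" for i
          using fun_cong[OF a(3), of i] that by simp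
        then have "restrict \<sigma> (set (x # xs)) = restrict \<tau> (set (x # xs))"
          using a(1,2) by (auto simp: fun_eq_iff restrict_def)
        then show "\<sigma> = \<tau>"
          using inj_onD[OF Cons.prems(7)] a(1,2) by blast
      qed
    qed (use Cons.prems in \<open>auto intro: inj_on_subset\<close>)
    then have "1 / real (card C) * (\<Sum>\<sigma>\<in>{\<sigma>\<in>F. \<sigma> x = y}. q (insert y U) \<sigma> xs) \<le> 1 / real (card C) * 1"
      by (intro mult_left_mono) auto
    then show "(\<Sum>\<sigma>\<in>{\<sigma>\<in>F. \<sigma> x = y}. q U \<sigma> (x # xs)) \<le> 1 / real (card C)"
      by (simp add: q_Cons sum_distrib_left)
  qed
  also have "\<dots> \<le> 1" by simp
  finally show ?case unfolding q_def .
qed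

text \<open>Gibbs' inequality for the uniform distribution on \<open>M\<close> against the subprobability \<open>q\<close>: it is the sum over
\<open>M\<close> of \<open>ln t \<le> t - 1\<close> at \<open>t = q x * card M\<close>.\<close>

lemma card_ln_card_le:
  fixes q :: "'a \<Rightarrow> real"
  assumes "\<And>x. x \<in> M \<Longrightarrow> q x > 0" and "sum q M \<le> 1"
  shows "real (card M) * ln (real (card M)) \<le> (\<Sum>x\<in>M. - ln (q x))"
proof (cases "card M = 0")
  case True
  then show ?thesis by (cases "finite M") auto
next
  case False
  let ?m = "real (card M)"
  have "(\<Sum>x\<in>M. ln (q x) + ln ?m) \<le> (\<Sum>x\<in>M. q x * ?m - 1)"
  proof (rule sum_mono)
    fix x assume "x \<in> M"
    then show "ln (q x) + ln ?m \<le> q x * ?m - 1"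
      using ln_le_minus_one[of "q x * ?m"] assms(1)[of x] False by (simp add: ln_mult)
  qed
  also have "\<dots> = sum q M * ?m - ?m"
    by (simp add: sum_subtractf sum_distrib_right)
  also have "\<dots> \<le> 0"
    using mult_right_mono[OF assms(2), of ?m] by simp
  finally show ?thesis
    by (simp add: sum.distrib sum_negf)
qed

section \<open>The rank of an element in a random order\<close>

text \<open>The suffix \<open>dropWhile (\<lambda>j. j \<noteq> i) xs\<close> consists of \<open>i\<close> and everything after it, so its intersection with
\<open>S\<close> gives the rank of \<open>i\<close> in \<open>S\<close>, counted from the end. Each rank from \<open>1\<close> to \<open>card S\<close> occurs once.\<close>

lemma sum_over_ranks:
  fixes F :: "nat \<Rightarrow> real"
  assumes "distinct xs" "S \<subseteq> set xs"
  shows "(\<Sum>i\<in>S. F (card (S \<inter> set (dropWhile (\<lambda>j. j \<noteq> i) xs)))) = (\<Sum>k=1..card S. F k)"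
  using assms
proof (induction xs arbitrary: S)
  case Nil
  then show ?case by simp
next
  case (Cons x xs)
  let ?S = "S - {x}"
  have fin: "finite S" using Cons.prems(2) finite_subset by blast
  have "(\<Sum>i\<in>?S. F (card (S \<inter> set (dropWhile (\<lambda>j. j \<noteq> i) (x # xs)))))
      = (\<Sum>i\<in>?S. F (card (?S \<inter> set (dropWhile (\<lambda>j. j \<noteq> i) xs))))"
  proof (rule sum.cong)
    fix i assume "i \<in> ?S"
    moreover have "x \<notin> set (dropWhile (\<lambda>j. j \<noteq> i) xs)"
      using Cons.prems(1) set_dropWhileD by fastforce
    then have "S \<inter> set (dropWhile (\<lambda>j. j \<noteq> i) xs) = ?S \<inter> set (dropWhile (\<lambda>j. j \<noteq> i) xs)"
      by blast
    ultimately show "F (card (S \<inter> set (dropWhile (\<lambda>j. j \<noteq> i) (x # xs))))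
        = F (card (?S \<inter> set (dropWhile (\<lambda>j. j \<noteq> i) xs)))"
      by auto
  qed simp
  also have "\<dots> = (\<Sum>k=1..card ?S. F k)"
    using Cons.prems by (intro Cons.IH) auto
  finally have rest: "(\<Sum>i\<in>?S. F (card (S \<inter> set (dropWhile (\<lambda>j. j \<noteq> i) (x # xs)))))
      = (\<Sum>k=1..card ?S. F k)" .
  show ?case
  proof (cases "x \<in> S")
    case True
    then have "card S = Suc (card ?S)"
      using fin by (metis card.remove)
    moreover have "S \<inter> set (x # xs) = S"
      using Cons.prems(2) by blast
    ultimately show ?thesis
      using rest by (subst sum.remove[OF fin True]) simp
  next
    case False
    then show ?thesis using rest by simp
  qed
qed

text \<open>In a uniformly random order all elements of \<open>S\<close> have the same distribution of ranks, because the transposition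
of two of them acts on the orders and preserves \<open>S\<close>. Hence the rank of \<open>i\<close> may be averaged
over \<open>S\<close>, and for every single order the ranks of the elements of \<open>S\<close> run through \<open>1, \<dots>, card S\<close>.\<close>

lemma rank_uniform:
  fixes F :: "nat \<Rightarrow> real"
  assumes "finite A" "S \<subseteq> A" "i \<in> S"
  shows "real (card S) *
      (\<Sum>xs\<in>permutations_of_set A. F (card (S \<inter> set (dropWhile (\<lambda>j. j \<noteq> i) xs))))
    = fact (card A) * (\<Sum>k=1..card S. F k)"
proof -
  let ?P = "permutations_of_set A"
  define f where "f i xs = F (card (S \<inter> set (dropWhile (\<lambda>j. j \<noteq> i) xs)))" for i xs
  have sym: "(\<Sum>xs\<in>?P. f j xs) = (\<Sum>xs\<in>?P. f i xs)" if "j \<in> S" for j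
  proof -
    let ?t = "transpose i j"
    have "f j (map ?t xs) = f i xs" for xs
    proof -
      have "(\<lambda>k. k \<noteq> j) \<circ> ?t = (\<lambda>k. k \<noteq> i)"
        by (auto simp: fun_eq_iff transpose_def)
      then have "set (dropWhile (\<lambda>k. k \<noteq> j) (map ?t xs)) = ?t ` set (dropWhile (\<lambda>k. k \<noteq> i) xs)"
        by (simp add: dropWhile_map)
      moreover have "?t ` S = S"
        using assms(3) that by simp
      ultimately have "S \<inter> set (dropWhile (\<lambda>k. k \<noteq> j) (map ?t xs))
          = ?t ` (S \<inter> set (dropWhile (\<lambda>k. k \<noteq> i) xs))"
        by (simp add: image_Int)
      then show ?thesis
        by (simp add: f_def card_image)
    qed
    moreover have "bij_betw (map ?t) ?P ?P"
    proof (rule bij_betw_byWitness[where f' = "map ?t"])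
      show "map ?t ` ?P \<subseteq> ?P"
      proof -
        have "?t ` A = A" using assms that by (intro transpose_image_eq) blast
        then show ?thesis
          by (auto simp: permutations_of_set_def distinct_map)
      qed
      then show "map ?t ` ?P \<subseteq> ?P" .
    qed (auto simp: o_def)
    ultimately show ?thesis
      using sum.reindex_bij_betw[of "map ?t" ?P ?P "f j"] by simp
  qed
  have "real (card S) * (\<Sum>xs\<in>?P. f i xs) = (\<Sum>j\<in>S. \<Sum>xs\<in>?P. f j xs)"
    using sym by simp
  also have "\<dots> = (\<Sum>xs\<in>?P. \<Sum>j\<in>S. f j xs)"
    by (rule sum.swap)
  also have "\<dots> = (\<Sum>xs\<in>?P. \<Sum>k=1..card S. F k)"
    unfolding f_def
    using assms(2) by (intro sum.cong sum_over_ranks) (auto simp: permutations_of_set_def)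
  also have "\<dots> = fact (card A) * (\<Sum>k=1..card S. F k)"
    using assms(1) by simp
  finally show ?thesis by (simp add: f_def)
qed

section \<open>The gain of an index\<close>

text \<open>Written as \<open>k! \<ge> (k + 1)\<close> to the power \<open>(k - 1) / 2\<close> with \<open>k = m + 2\<close>, this is what makes the gain below decrease.
It comes from pairing the factors \<open>i\<close> and \<open>k + 2 - i\<close> of two copies of \<open>k!\<close> for \<open>2 \<le> i \<le> k\<close>: each of these
\<open>k - 1\<close> products is at least \<open>2 * k\<close>.\<close>

lemma fact_squared_ge:
  "(m + 3) ^ (m + 1) \<le> (fact (m + 2) :: nat)\<^sup>2"
proof -
  have eq: "(\<Prod>k=2..m+2. k) = (fact (m + 2) :: nat)"
    by (induction m) (auto simp: prod.nat_ivl_Suc' numeral_2_eq_2)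
  have "(m + 3) ^ (m + 1) = (\<Prod>k=2..m+2. m + 3)"
    by simp
  also have "\<dots> \<le> (\<Prod>k=2..m+2. k * (m + 4 - k))"
  proof (rule prod_mono)
    fix k assume "k \<in> {2..m+2}"
    then obtain a b where "k = a + 2" "m = a + b"
      by (metis add.commute atLeastAtMost_iff le_Suc_ex nat_add_left_cancel_le)
    then show "0 \<le> m + 3 \<and> m + 3 \<le> k * (m + 4 - k)"
      by (simp add: algebra_simps)
  qed
  also have "\<dots> = (\<Prod>k=2..m+2. k) * (\<Prod>k=2..m+2. m + 4 - k)"
    by (rule prod.distrib)
  also have "(\<Prod>k=2..m+2. m + 4 - k) = (\<Prod>k=2..m+2. k)"
    by (rule prod.reindex_bij_witness[of _ "\<lambda>k. m + 4 - k" "\<lambda>k. m + 4 - k"]) auto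
  finally show ?thesis
    by (simp only: eq power2_eq_square)
qed

text \<open>For \<open>k \<ge> 2\<close> this is, by \<open>log_gain_split\<close>, the difference of the exponents \<open>ln k! / (k - 1)\<close> and \<open>ln k! / k\<close>, the price of
replacing \<open>1 / k\<close> by \<open>1 / (k - 1)\<close> in the bound for a vertex of degree \<open>k\<close>. Its value at \<open>k = 1\<close> is \<open>0\<close>.\<close>

definition log_gain :: "nat \<Rightarrow> real" where
  "log_gain k = ln (fact k) / (real k * (real k - 1))"

lemma log_gain_Suc_le:
  assumes "k \<ge> 2"
  shows "log_gain (Suc k) \<le> log_gain k"
proof -
  obtain m where m: "k = m + 2" using assms by (metis add.commute le_Suc_ex)
  have "real ((m + 3) ^ (m + 1)) \<le> real ((fact (m + 2))\<^sup>2)"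
    using fact_squared_ge of_nat_mono by blast
  moreover have "real (m + 3) = real k + 1" by (simp add: m)
  ultimately have "(real k + 1) ^ (m + 1) \<le> (fact k)\<^sup>2"
    unfolding m by (metis of_nat_fact of_nat_power)
  then have "ln ((real k + 1) ^ (m + 1)) \<le> ln ((fact k :: real)\<^sup>2)"
    by (subst ln_le_cancel_iff) auto
  then have key: "(real k - 1) * ln (real k + 1) \<le> 2 * ln (fact k)"
    by (simp only: ln_realpow) (simp add: m ln_realpow del: fact_Suc)
  have "ln (fact (Suc k)) = ln (real k + 1) + ln (fact k :: real)"
    by (simp add: ln_mult add.commute)
  then have "log_gain (Suc k) = (ln (real k + 1) + ln (fact k)) / ((real k + 1) * real k)"
    by (simp add: log_gain_def add.commute)
  also have "\<dots> = (ln (real k + 1) + ln (fact k)) * (real k - 1) / ((real k + 1) * real k * (real k - 1))"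
    using assms by simp
  also have "\<dots> \<le> ln (fact k) * (real k + 1) / ((real k + 1) * real k * (real k - 1))"
  proof (rule divide_right_mono)
    show "(ln (real k + 1) + ln (fact k)) * (real k - 1) \<le> ln (fact k) * (real k + 1)"
      using key by (simp add: algebra_simps)
    show "0 \<le> (real k + 1) * real k * (real k - 1)"
      using assms by (intro mult_nonneg_nonneg) auto
  qed
  also have "\<dots> = log_gain k"
    by (simp add: log_gain_def)
  finally show ?thesis .
qed

lemma log_gain_antimono:
  assumes "2 \<le> a" "a \<le> b"
  shows "log_gain b \<le> log_gain a"
  using assms(2)
proof (induction b rule: dec_induct)
  case (step b)
  then show ?case using log_gain_Suc_le[of b] assms(1) by linarith
qed simp

lemma log_gain_nonneg: "log_gain k \<ge> 0"
  by (cases k) (auto simp: log_gain_def simp del: fact_Suc intro!: divide_nonneg_nonneg ln_ge_zero fact_ge_1)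

lemma log_gain_split:
  assumes "k \<ge> 2"
  shows "ln (fact k) / (real k - 1) = ln (fact k) / real k + log_gain k"
  using assms by (simp add: log_gain_def field_simps)

text \<open>For decreasing nonnegative weights, \<open>k\<close> of the indices \<open>l, \<dots>, m\<close> have the largest sum if they are the first
\<open>k\<close>: the elements of \<open>T\<close> from \<open>l + k\<close> on can be exchanged for elements missing from the initial segment, and
\<open>g (l + k)\<close> separates the weights of the two.\<close>

lemma sum_antimono_le_initial:
  fixes g :: "nat \<Rightarrow> real"
  assumes "T \<subseteq> {l..m}" and "card T \<le> k"
    and anti: "\<And>i j. l \<le> i \<Longrightarrow> i \<le> j \<Longrightarrow> j \<le> m \<Longrightarrow> g j \<le> g i"
    and nonneg: "\<And>i. g i \<ge> 0"
  shows "sum g T \<le> sum g ({l..<l+k} \<inter> {l..m})"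
proof -
  let ?I = "{l..<l+k} \<inter> {l..m}"
  have finT: "finite T" using assms(1) finite_subset by blast
  show ?thesis
  proof (cases "m < l + k")
    case True
    then have "T \<subseteq> ?I" using assms(1) by auto
    then show ?thesis using nonneg by (intro sum_mono2) auto
  next
    case False
    then have I: "?I = {l..<l+k}" by auto
    have "card (T - ?I) \<le> card (?I - T)"
    proof -
      have "card T = card (T - ?I) + card (T \<inter> ?I)"
        using finT by (metis Int_Diff_Un card_Un_disjoint finite_Diff finite_Int Int_Diff_disjoint add.commute)
      moreover have "card ?I = card (?I - T) + card (T \<inter> ?I)"
        by (metis Int_Diff_Un card_Un_disjoint finite_Diff finite_Int Int_Diff_disjoint add.commute finite_atLeastLessThan Int_commute)
      moreover have "card ?I = k" using I by simp
      ultimately show ?thesis using assms(2) by linarith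
    qed
    moreover have "sum g (T - ?I) \<le> real (card (T - ?I)) * g (l + k)"
      using assms(1) I by (intro sum_bounded_above anti) auto
    moreover have "real (card (?I - T)) * g (l + k) \<le> sum g (?I - T)"
      using False I by (intro sum_bounded_below anti) auto
    moreover have "real (card (T - ?I)) * g (l + k) \<le> real (card (?I - T)) * g (l + k)"
      if "card (T - ?I) \<le> card (?I - T)"
      using that nonneg by (intro mult_right_mono) auto
    ultimately have "sum g (T - ?I) \<le> sum g (?I - T)" by linarith
    moreover have "sum g T = sum g (T \<inter> ?I) + sum g (T - ?I)"
      using finT by (rule sum.Int_Diff)
    moreover have "sum g ?I = sum g (?I \<inter> T) + sum g (?I - T)"
      by (rule sum.Int_Diff) simp
    ultimately show ?thesis by (simp add: Int_commute)
  qed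
qed

section \<open>Counting bijective selections\<close>

text \<open>Perfect matchings between \<open>A\<close> and \<open>B\<close> as functions; extensionality makes the set of these
functions finite and equality a matter of the values on \<open>A\<close>.\<close>

definition bij_selections :: "('i \<Rightarrow> 'b set) \<Rightarrow> 'i set \<Rightarrow> 'b set \<Rightarrow> ('i \<Rightarrow> 'b) set" where
  "bij_selections N A B = {\<sigma> \<in> A \<rightarrow>\<^sub>E B. bij_betw \<sigma> A B \<and> (\<forall>i\<in>A. \<sigma> i \<in> N i)}"

lemma finite_bij_selections: "finite A \<Longrightarrow> finite B \<Longrightarrow> finite (bij_selections N A B)"
  unfolding bij_selections_def by (rule finite_subset[OF _ finite_PiE[of A "\<lambda>_. B"]]) auto

lemma bij_selection_card_vimage:
  assumes "\<sigma> \<in> bij_selections N A B" "C \<subseteq> B"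
  shows "card {j \<in> A. \<sigma> j \<in> C} = card C"
proof -
  have "bij_betw \<sigma> {j \<in> A. \<sigma> j \<in> C} C"
    using assms by (auto simp: bij_selections_def bij_betw_def inj_on_def)
  then show ?thesis by (rule bij_betw_same_card)
qed

text \<open>A bijection onto \<open>B\<close> has only one value left for the last index. This allows the greedy process to omit \<open>r\<close>, so
that \<open>r\<close> costs nothing in the final bound.\<close>

lemma bij_selections_inj_restrict:
  assumes "r \<in> A"
  shows "inj_on (\<lambda>\<sigma>. restrict \<sigma> (A - {r})) (bij_selections N A B)"
proof (rule inj_onI)
  fix \<sigma> \<tau> assume \<sigma>: "\<sigma> \<in> bij_selections N A B" and \<tau>: "\<tau> \<in> bij_selections N A B"
    and "restrict \<sigma> (A - {r}) = restrict \<tau> (A - {r})"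
  then have eq: "\<sigma> i = \<tau> i" if "i \<in> A - {r}" for i
    using that by (metis restrict_apply')
  have r: "\<rho> r \<in> B - \<rho> ` (A - {r})" and B: "B = insert (\<rho> r) (\<rho> ` (A - {r}))"
    if "\<rho> \<in> bij_selections N A B" for \<rho>
    using that assms by (auto simp: bij_selections_def bij_betw_def inj_on_def)
  have "\<sigma> ` (A - {r}) = \<tau> ` (A - {r})"
    using eq by (intro image_cong) auto
  then have "\<sigma> r = \<tau> r"
    using r[OF \<sigma>] B[OF \<tau>] by auto
  then have "\<sigma> i = \<tau> i" if "i \<in> A" for i
    using eq that by blast
  moreover have "\<sigma> \<in> extensional A" "\<tau> \<in> extensional A"
    using \<sigma> \<tau> by (auto simp: bij_selections_def PiE_def)
  ultimately show "\<sigma> = \<tau>"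
    by (metis extensionalityI)
qed

text \<open>For one fixed order \<open>xs\<close>, Gibbs' inequality is applied to the probabilities of the greedy process on
\<open>A - {r}\<close>. Because \<open>\<sigma>\<close> is a bijection, the elements of \<open>N i\<close> still free when \<open>i\<close> is visited can be
counted by their preimages, which are indices not visited before \<open>i\<close>; among them is always \<open>r\<close> if
\<open>\<sigma> r \<in> N i\<close>.\<close>

lemma card_ln_card_le_sum_choices:
  fixes N :: "'i \<Rightarrow> 'b set" and A B r
  defines "M \<equiv> bij_selections N A B"
  assumes "finite A" "finite B" "r \<in> A" and N: "\<And>i. i \<in> A \<Longrightarrow> N i \<subseteq> B"
    and xs: "xs \<in> permutations_of_set (A - {r})"
  shows "real (card M) * ln (real (card M)) \<le>
    (\<Sum>\<sigma>\<in>M. \<Sum>i\<in>A-{r}. ln (real (card {j \<in> A. \<sigma> j \<in> N i \<and> j \<notin> set (takeWhile (\<lambda>j. j \<noteq> i) xs)})))"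
proof -
  have set_xs: "set xs = A - {r}" and "distinct xs"
    using xs by (auto simp: permutations_of_set_def)
  define c where "c \<sigma> i = real (card (N i - ({} \<union> \<sigma> ` set (takeWhile (\<lambda>j. j \<noteq> i) xs))))" for \<sigma> i
  have c: "c \<sigma> i = real (card {j \<in> A. \<sigma> j \<in> N i \<and> j \<notin> set (takeWhile (\<lambda>j. j \<noteq> i) xs)})"
    if "\<sigma> \<in> M" "i \<in> A" for \<sigma> i
  proof -
    let ?C = "N i - \<sigma> ` set (takeWhile (\<lambda>j. j \<noteq> i) xs)"
    have "set (takeWhile (\<lambda>j. j \<noteq> i) xs) \<subseteq> A"
      using set_xs set_takeWhileD by fastforce
    moreover have "inj_on \<sigma> A" using that by (simp add: M_def bij_selections_def bij_betw_def)
    ultimately have "{j \<in> A. \<sigma> j \<in> N i \<and> j \<notin> set (takeWhile (\<lambda>j. j \<noteq> i) xs)} = {j \<in> A. \<sigma> j \<in> ?C}"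
      by (auto simp: inj_on_def)
    moreover have "?C \<subseteq> B" using N[OF \<open>i \<in> A\<close>] by blast
    then have "card {j \<in> A. \<sigma> j \<in> ?C} = card ?C"
      using that by (intro bij_selection_card_vimage) (auto simp: M_def)
    ultimately show ?thesis by (simp only: c_def Un_empty_left)
  qed
  have pos: "c \<sigma> i > 0" if "\<sigma> \<in> M" "i \<in> A" for \<sigma> i
  proof -
    have "i \<in> {j \<in> A. \<sigma> j \<in> N i \<and> j \<notin> set (takeWhile (\<lambda>j. j \<noteq> i) xs)}"
      using that by (auto simp: M_def bij_selections_def dest: set_takeWhileD)
    then show ?thesis
      using c[OF that] \<open>finite A\<close> by (auto simp: card_gt_0_iff)
  qed
  have "real (card M) * ln (real (card M)) \<le> (\<Sum>\<sigma>\<in>M. - ln (\<Prod>i\<in>set xs. 1 / c \<sigma> i))"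
  proof (rule card_ln_card_le)
    show "(\<Sum>\<sigma>\<in>M. \<Prod>i\<in>set xs. 1 / c \<sigma> i) \<le> 1"
      unfolding c_def
    proof (rule sum_prod_inverse_choices_le_1)
      show "finite M" using assms finite_bij_selections by blast
      show "inj_on (\<lambda>\<sigma>. restrict \<sigma> (set xs)) M"
        unfolding set_xs M_def using \<open>r \<in> A\<close> by (rule bij_selections_inj_restrict)
      show "inj_on \<sigma> (set xs)" if "\<sigma> \<in> M" for \<sigma>
        using that set_xs by (auto simp: M_def bij_selections_def bij_betw_def intro: inj_on_subset)
      show "finite (N i)" if "i \<in> set xs" for i
        using that set_xs N \<open>finite B\<close> by (metis DiffD1 finite_subset)
    qed (use \<open>distinct xs\<close> set_xs in \<open>auto simp: M_def bij_selections_def\<close>)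
  next
    fix \<sigma> assume "\<sigma> \<in> M"
    then show "0 < (\<Prod>i\<in>set xs. 1 / c \<sigma> i)"
      using pos set_xs by (intro prod_pos) simp
  qed
  also have "\<dots> = (\<Sum>\<sigma>\<in>M. \<Sum>i\<in>A-{r}. ln (real (card {j \<in> A. \<sigma> j \<in> N i \<and> j \<notin> set (takeWhile (\<lambda>j. j \<noteq> i) xs)})))"
  proof (rule sum.cong)
    fix \<sigma> assume "\<sigma> \<in> M"
    have "ln (\<Prod>i\<in>set xs. 1 / c \<sigma> i) = (\<Sum>i\<in>set xs. ln (1 / c \<sigma> i))"
      using pos[OF \<open>\<sigma> \<in> M\<close>] set_xs \<open>finite A\<close> by (intro ln_prod) (simp_all add: less_imp_neq[symmetric])
    also have "\<dots> = (\<Sum>i\<in>A-{r}. - ln (c \<sigma> i))"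
      unfolding set_xs using pos[OF \<open>\<sigma> \<in> M\<close>] by (intro sum.cong) (auto simp: ln_div)
    finally show "- ln (\<Prod>i\<in>set xs. 1 / c \<sigma> i) = (\<Sum>i\<in>A-{r}. ln (real (card {j \<in> A. \<sigma> j \<in> N i \<and> j \<notin> set (takeWhile (\<lambda>j. j \<noteq> i) xs)})))"
      using c[OF \<open>\<sigma> \<in> M\<close>] by (simp add: sum_negf)
  qed simp
  finally show ?thesis .
qed

lemma ln_fact_sum: "(\<Sum>k=1..m. ln (real k)) = ln (fact m)"
  by (induction m) (simp_all add: ln_mult add.commute)

text \<open>For fixed \<open>\<sigma>\<close>, averaging over all orders of \<open>A - {r}\<close> makes the number of free choices of \<open>i\<close>
uniformly distributed, by \<open>rank_uniform\<close>. If \<open>\<sigma> r \<notin> N i\<close>, it is uniform on \<open>1, \<dots>, d\<close>, and the mean of its logarithm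
is \<open>ln d! / d\<close>. If \<open>\<sigma> r \<in> N i\<close>, that element of \<open>N i\<close> is never taken, the number is uniform on
\<open>2, \<dots>, d\<close>, and the mean is \<open>ln d! / (d - 1)\<close>.\<close>

lemma sum_ln_choices:
  fixes N :: "'i \<Rightarrow> 'b set"
  assumes \<sigma>: "\<sigma> \<in> bij_selections N A B" and "finite A" "r \<in> A" and i: "i \<in> A - {r}" and N: "N i \<subseteq> B"
  defines "d \<equiv> card (N i)"
  shows "(\<Sum>xs\<in>permutations_of_set (A - {r}).
      ln (real (card {j \<in> A. \<sigma> j \<in> N i \<and> j \<notin> set (takeWhile (\<lambda>j. j \<noteq> i) xs)})))
    = fact (card (A - {r})) * (ln (fact d) / real d + (if \<sigma> r \<in> N i then log_gain d else 0))"
proof -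
  let ?P = "permutations_of_set (A - {r})"
  define S where "S = {j \<in> A - {r}. \<sigma> j \<in> N i}"
  define e :: nat where "e = (if \<sigma> r \<in> N i then 1 else 0)"
  have iS: "i \<in> S" using i \<sigma> by (auto simp: S_def bij_selections_def)
  have finS: "finite S" using \<open>finite A\<close> by (simp add: S_def)
  have "r \<notin> S" by (simp add: S_def)
  have "{j \<in> A. \<sigma> j \<in> N i} = S \<union> (if \<sigma> r \<in> N i then {r} else {})"
    using \<open>r \<in> A\<close> by (auto simp: S_def)
  moreover have "card (S \<union> (if \<sigma> r \<in> N i then {r} else {})) = card S + e"
    using finS \<open>r \<notin> S\<close> by (simp add: e_def)
  ultimately have d: "d = card S + e"
    using bij_selection_card_vimage[OF \<sigma> N] by (simp only: d_def)
  have cS: "card S > 0" using iS finS by (auto simp: card_gt_0_iff)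
  have choices: "card {j \<in> A. \<sigma> j \<in> N i \<and> j \<notin> set (takeWhile (\<lambda>j. j \<noteq> i) xs)}
      = card (S \<inter> set (dropWhile (\<lambda>j. j \<noteq> i) xs)) + e" if "xs \<in> ?P" for xs
  proof -
    have set_xs: "set xs = A - {r}" and "distinct xs"
      using that by (auto simp: permutations_of_set_def)
    then have "set (takeWhile (\<lambda>j. j \<noteq> i) xs) \<inter> set (dropWhile (\<lambda>j. j \<noteq> i) xs) = {}"
      by (metis distinct_append takeWhile_dropWhile_id)
    moreover have un: "set (takeWhile (\<lambda>j. j \<noteq> i) xs) \<union> set (dropWhile (\<lambda>j. j \<noteq> i) xs) = A - {r}"
      by (metis set_append set_xs takeWhile_dropWhile_id)
    ultimately have "{j \<in> A. \<sigma> j \<in> N i \<and> j \<notin> set (takeWhile (\<lambda>j. j \<noteq> i) xs)}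
        = (S \<inter> set (dropWhile (\<lambda>j. j \<noteq> i) xs)) \<union> (if \<sigma> r \<in> N i then {r} else {})"
      using \<open>r \<in> A\<close> by (auto simp: S_def)
    then show ?thesis
      using finS \<open>r \<notin> S\<close> by (simp add: e_def)
  qed
  have "real (card S) * (\<Sum>xs\<in>?P. ln (real (card {j \<in> A. \<sigma> j \<in> N i \<and> j \<notin> set (takeWhile (\<lambda>j. j \<noteq> i) xs)})))
      = real (card S) * (\<Sum>xs\<in>?P. ln (real (card (S \<inter> set (dropWhile (\<lambda>j. j \<noteq> i) xs)) + e)))"
    using choices by simp
  also have "\<dots> = fact (card (A - {r})) * (\<Sum>k=1..card S. ln (real (k + e)))"
    using \<open>finite A\<close> iS by (intro rank_uniform[where F = "\<lambda>k. ln (real (k + e))"]) (auto simp: S_def)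
  also have "(\<Sum>k=1..card S. ln (real (k + e))) = ln (fact d)"
  proof (cases "\<sigma> r \<in> N i")
    case True
    have "ln (fact d) = (\<Sum>k=1..Suc (card S). ln (real k))"
      using True by (simp only: ln_fact_sum d e_def if_True Suc_eq_plus1)
    also have "\<dots> = (\<Sum>k=1..card S. ln (real (k + 1)))"
      by (subst sum.atLeast_Suc_atMost) (simp_all del: sum.cl_ivl_Suc add: sum.shift_bounds_cl_Suc_ivl)
    finally show ?thesis using True by (simp add: e_def)
  next
    case False
    then show ?thesis using ln_fact_sum[of d] by (simp add: d e_def)
  qed
  finally have "(\<Sum>xs\<in>?P. ln (real (card {j \<in> A. \<sigma> j \<in> N i \<and> j \<notin> set (takeWhile (\<lambda>j. j \<noteq> i) xs)})))
      = fact (card (A - {r})) * (ln (fact d) / real (card S))"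
    using cS by (simp add: field_simps)
  also have "ln (fact d) / real (card S) = ln (fact d) / real d + (if \<sigma> r \<in> N i then log_gain d else 0)"
  proof (cases "\<sigma> r \<in> N i")
    case True
    then have "d \<ge> 2" "real (card S) = real d - 1" using cS d by (auto simp: e_def)
    then show ?thesis using True log_gain_split[of d] by simp
  next
    case False
    then show ?thesis using d by (simp add: e_def)
  qed
  finally show ?thesis .
qed

text \<open>Averaging \<open>card_ln_card_le_sum_choices\<close> over all orders \<open>xs\<close> gives Bregman's exponent for every index except
\<open>r\<close>, plus the mean over \<open>\<sigma>\<close> of the total gain of the indices \<open>i\<close> with \<open>\<sigma> r \<in> N i\<close>. A bound \<open>K\<close> on this
total for every possible value \<open>y\<close> of \<open>\<sigma> r\<close> bounds its mean.\<close>

lemma card_bij_selections_le: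
  fixes N :: "'i \<Rightarrow> 'b set" and A B r
  defines "M \<equiv> bij_selections N A B"
  assumes "finite A" "finite B" "r \<in> A" and N: "\<And>i. i \<in> A \<Longrightarrow> N i \<subseteq> B"
    and gain: "\<And>y. y \<in> N r \<Longrightarrow> (\<Sum>i\<in>{i\<in>A-{r}. y \<in> N i}. log_gain (card (N i))) \<le> K"
  shows "real (card M) \<le> exp ((\<Sum>i\<in>A-{r}. ln (fact (card (N i))) / real (card (N i))) + K)"
proof (cases "card M = 0")
  case False
  let ?P = "permutations_of_set (A - {r})"
  define C where "C = (\<Sum>i\<in>A-{r}. ln (fact (card (N i))) / real (card (N i)))"
  define c where "c \<sigma> i xs = ln (real (card {j \<in> A. \<sigma> j \<in> N i \<and> j \<notin> set (takeWhile (\<lambda>j. j \<noteq> i) xs)}))"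
    for \<sigma> i xs
  define f :: real where "f = fact (card (A - {r}))"
  have "f > 0" by (simp add: f_def)
  have "f * (real (card M) * ln (real (card M))) = (\<Sum>xs\<in>?P. real (card M) * ln (real (card M)))"
    using \<open>finite A\<close> by (simp add: f_def)
  also have "\<dots> \<le> (\<Sum>xs\<in>?P. \<Sum>\<sigma>\<in>M. \<Sum>i\<in>A-{r}. c \<sigma> i xs)"
    unfolding c_def M_def using assms by (intro sum_mono card_ln_card_le_sum_choices) auto
  also have "\<dots> = (\<Sum>\<sigma>\<in>M. \<Sum>i\<in>A-{r}. \<Sum>xs\<in>?P. c \<sigma> i xs)"
    by (subst sum.swap, rule sum.cong[OF refl], subst sum.swap, rule refl)
  also have "\<dots> \<le> (\<Sum>\<sigma>\<in>M. f * (C + K))"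
  proof (rule sum_mono)
    fix \<sigma> assume \<sigma>: "\<sigma> \<in> M"
    then have "\<sigma> r \<in> N r" using \<open>r \<in> A\<close> by (auto simp: M_def bij_selections_def)
    have "(\<Sum>i\<in>A-{r}. \<Sum>xs\<in>?P. c \<sigma> i xs)
      = (\<Sum>i\<in>A-{r}. f * (ln (fact (card (N i))) / real (card (N i))
          + (if \<sigma> r \<in> N i then log_gain (card (N i)) else 0)))"
      unfolding c_def f_def using \<sigma> assms by (intro sum.cong sum_ln_choices) (auto simp: M_def)
    also have "\<dots> = f * (C + (\<Sum>i\<in>A-{r}. if \<sigma> r \<in> N i then log_gain (card (N i)) else 0))"
      by (simp only: sum_distrib_left[symmetric] sum.distrib C_def)
    also have "(\<Sum>i\<in>A-{r}. if \<sigma> r \<in> N i then log_gain (card (N i)) else 0)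
        = (\<Sum>i\<in>{i\<in>A-{r}. \<sigma> r \<in> N i}. log_gain (card (N i)))"
      using \<open>finite A\<close> by (intro sum.inter_filter[symmetric]) auto
    finally show "(\<Sum>i\<in>A-{r}. \<Sum>xs\<in>?P. c \<sigma> i xs) \<le> f * (C + K)"
      using gain[OF \<open>\<sigma> r \<in> N r\<close>] \<open>f > 0\<close> by simp
  qed
  also have "\<dots> = f * (real (card M) * (C + K))" by simp
  finally have "ln (real (card M)) \<le> C + K"
    using \<open>f > 0\<close> False by simp
  then show ?thesis
    unfolding C_def[symmetric] using False by (metis exp_le_cancel_iff exp_ln neq0_conv of_nat_0_less_iff)
qed simp

section \<open>Perfect matchings of bipartite graphs\<close>

lemma vertex_degree_eq_card_neighbours:
  assumes "bipartite_graph V E (v ` I) (w ` J)" "inj_on w J" "i \<in> I"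
  shows "vertex_degree E (v i) = card {j \<in> J. {v i, w j} \<in> E}"
proof -
  have disj: "v i \<noteq> w j" if "j \<in> J" for j
    using assms(1,3) that by (auto simp: bipartite_graph_def)
  have "bij_betw (\<lambda>j. {v i, w j}) {j \<in> J. {v i, w j} \<in> E} {e \<in> E. v i \<in> e}"
  proof (rule bij_betw_imageI)
    show "inj_on (\<lambda>j. {v i, w j}) {j \<in> J. {v i, w j} \<in> E}"
      using assms(2) disj by (auto simp: inj_on_def doubleton_eq_iff)
    have "\<exists>j\<in>J. e = {v i, w j}" if "e \<in> E" "v i \<in> e" for e
      using assms(1) that disj unfolding bipartite_graph_def by fastforce
    then show "(\<lambda>j. {v i, w j}) ` {j \<in> J. {v i, w j} \<in> E} = {e \<in> E. v i \<in> e}"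
      by blast
  qed
  then show ?thesis
    unfolding vertex_degree_def by (rule bij_betw_same_card[symmetric])
qed

lemma bipartite_graph_commute: "bipartite_graph V E A B \<Longrightarrow> bipartite_graph V E B A"
  by (auto simp: bipartite_graph_def) (metis (no_types) doubleton_eq_iff)

text \<open>In this existential form, the perfect matchings are a subset of an image of the bijective selections, which
bounds their number without a choice of the selection belonging to a matching.\<close>

lemma perfect_matching_from_selection:
  assumes G: "bipartite_graph V E (v ` I) (w ` I)" and "finite I" "inj_on v I"
    and m: "m \<in> perfect_matchings V E"
  shows "\<exists>\<sigma> \<in> bij_selections (\<lambda>i. {j \<in> I. {v i, w j} \<in> E}) I I. m = (\<lambda>i. {v i, w (\<sigma> i)}) ` I"
proof -
  have V: "V = v ` I \<union> w ` I"
    using G by (simp add: bipartite_graph_def)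
  have disj: "v i \<noteq> w j" if "i \<in> I" "j \<in> I" for i j
    using G that by (auto simp: bipartite_graph_def)
  have mE: "m \<subseteq> E" and ex: "x \<in> V \<Longrightarrow> \<exists>e\<in>m. x \<in> e"
    and uniq: "x \<in> V \<Longrightarrow> e \<in> m \<Longrightarrow> e' \<in> m \<Longrightarrow> x \<in> e \<Longrightarrow> x \<in> e' \<Longrightarrow> e = e'" for x e e'
    using m unfolding perfect_matchings_def by blast+
  have edge: "\<exists>i\<in>I. \<exists>j\<in>I. e = {v i, w j}" if "e \<in> m" for e
    using that mE G unfolding bipartite_graph_def by blast
  have "\<exists>j\<in>I. {v i, w j} \<in> m" if "i \<in> I" for i
  proof -
    obtain e where e: "e \<in> m" "v i \<in> e" using ex[of "v i"] V \<open>i \<in> I\<close> by blast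
    then obtain i' j where "i' \<in> I" "j \<in> I" "e = {v i', w j}" using edge by blast
    then show ?thesis using e disj[OF that] by auto
  qed
  then obtain f where f: "\<And>i. i \<in> I \<Longrightarrow> f i \<in> I \<and> {v i, w (f i)} \<in> m"
    by metis
  let ?\<sigma> = "restrict f I"
  have "inj_on f I"
  proof (rule inj_onI)
    fix i i' assume i: "i \<in> I" "i' \<in> I" "f i = f i'"
    then have "{v i, w (f i)} = {v i', w (f i)}"
      using f[of i] f[of i'] V by (intro uniq[of "w (f i)"]) auto
    then have "v i = v i'" using disj i f by (auto simp: doubleton_eq_iff)
    then show "i = i'" using \<open>inj_on v I\<close> i by (auto dest: inj_onD)
  qed
  moreover have "f ` I = I"
    using \<open>finite I\<close> _ \<open>inj_on f I\<close> by (rule endo_inj_surj) (use f in auto)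
  ultimately have "bij_betw ?\<sigma> I I"
    by (simp add: bij_betw_def inj_on_restrict_eq)
  moreover have "m = (\<lambda>i. {v i, w (?\<sigma> i)}) ` I"
  proof
    show "m \<subseteq> (\<lambda>i. {v i, w (?\<sigma> i)}) ` I"
    proof
      fix e assume e: "e \<in> m"
      then obtain i j where ij: "i \<in> I" "j \<in> I" "e = {v i, w j}" using edge by blast
      then have "e = {v i, w (f i)}"
        using f[of i] e V by (intro uniq[of "v i"]) auto
      then show "e \<in> (\<lambda>i. {v i, w (?\<sigma> i)}) ` I" using ij by auto
    qed
  qed (use f in auto)
  ultimately show ?thesis
    using f mE by (intro bexI[of _ ?\<sigma>]) (auto simp: bij_selections_def)
qed

lemma card_perfect_matchings_le:
  assumes "bipartite_graph V E (v ` I) (w ` I)" "finite I" "inj_on v I"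
  shows "card (perfect_matchings V E) \<le> card (bij_selections (\<lambda>i. {j \<in> I. {v i, w j} \<in> E}) I I)"
proof (rule surj_card_le)
  show "perfect_matchings V E
      \<subseteq> (\<lambda>\<sigma>. (\<lambda>i. {v i, w (\<sigma> i)}) ` I) ` bij_selections (\<lambda>i. {j \<in> I. {v i, w j} \<in> E}) I I"
    using perfect_matching_from_selection[OF assms] by blast
qed (simp add: finite_bij_selections assms(2))

theorem theorem1p2:
  fixes V :: "'a set" and E :: "'a set set"
    and v w :: "nat \<Rightarrow> 'a"
    and d D :: "nat \<Rightarrow> nat"
    and n l p :: nat
  assumes "n \<ge> 1"
    and "bipartite_graph V E (v ` {1..n}) (w ` {1..n})"
    and "inj_on v {1..n}" and "inj_on w {1..n}"
    and "\<And>i. i \<in> {1..n} \<Longrightarrow> d i = vertex_degree E (v i)"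
    and "\<And>i. i \<in> {1..n} \<Longrightarrow> D i = vertex_degree E (w i)"
    and "1 \<le> d 1" and "mono_on {1..n} d"
    and "1 \<le> D 1" and "mono_on {1..n} D"
    and "l = (if \<exists>i\<in>{1..n}. d i > 1 then Min {i \<in> {1..n}. d i > 1} else n + 1)"
    and "p = min (D n + l - 2) (n - 1)"
  shows "real (card (perfect_matchings V E))
    \<le> (\<Prod>i=l..p. real (fact (d i)) powr (1 / (real (d i) - 1)))
      * (\<Prod>i=p+1..n-1. real (fact (d i)) powr (1 / real (d i)))"
proof -
  let ?A = "{1..n}"
  define N where "N i = {j \<in> ?A. {v i, w j} \<in> E}" for i
  define K where "K = (\<Sum>i=l..p. log_gain (d i))"
  have dN: "card (N i) = d i" if "i \<in> ?A" for i
    unfolding N_def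
    using vertex_degree_eq_card_neighbours[OF assms(2,4) that] assms(5)[OF that] by simp
  have DN: "card {i \<in> ?A. j \<in> N i} = D j" if "j \<in> ?A" for j
  proof -
    have "{i \<in> ?A. j \<in> N i} = {i \<in> ?A. {w j, v i} \<in> E}"
      using that by (auto simp: N_def insert_commute)
    then show ?thesis
      using vertex_degree_eq_card_neighbours[OF bipartite_graph_commute[OF assms(2)] assms(3) that]
        assms(6)[OF that] by simp
  qed
  have d_mono: "d i \<le> d j" if "1 \<le> i" "i \<le> j" "j \<le> n" for i j
    using assms(8) that by (auto simp: monotone_on_def)
  have D_mono: "D i \<le> D j" if "1 \<le> i" "i \<le> j" "j \<le> n" for i j
    using assms(10) that by (auto simp: monotone_on_def)
  have d_pos: "1 \<le> d i" if "i \<in> ?A" for i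
    using assms(7) d_mono[of 1 i] that by auto
  have l: "1 \<le> l" "l \<le> n + 1" and d_ge2: "\<And>i. l \<le> i \<Longrightarrow> i \<le> n \<Longrightarrow> 2 \<le> d i"
    and d_eq1: "\<And>i. 1 \<le> i \<Longrightarrow> i < l \<Longrightarrow> i \<le> n \<Longrightarrow> d i = 1"
  proof -
    let ?L = "{i \<in> ?A. d i > 1}"
    have l_in: "l \<in> ?L" if "?L \<noteq> {}"
    proof -
      have "l = Min ?L" using that assms(11) by auto
      then show ?thesis using that Min_in[of ?L] by simp
    qed
    have l_empty: "l = n + 1" if "?L = {}"
      using that assms(11) by auto
    show l1: "1 \<le> l" using l_in l_empty by (cases "?L = {}") auto
    show "l \<le> n + 1" using l_in l_empty by (cases "?L = {}") auto
    show "2 \<le> d i" if "l \<le> i" "i \<le> n" for i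
    proof -
      have "?L \<noteq> {}" using l_empty that by linarith
      then have "1 < d l" using l_in by blast
      then show ?thesis using d_mono[OF l1 that] by linarith
    qed
    show "d i = 1" if "1 \<le> i" "i < l" "i \<le> n" for i
    proof -
      have "i \<notin> ?L"
      proof
        assume "i \<in> ?L"
        then have "l = Min ?L" using assms(11) by auto
        then have "l \<le> i" using \<open>i \<in> ?L\<close> by simp
        then show False using \<open>i < l\<close> by simp
      qed
      then show ?thesis using d_pos[of i] that by simp
    qed
  qed
  have Dn: "1 \<le> D n" using D_mono[of 1 n] assms(1,9) by auto
  \<comment> \<open>If \<open>l = n + 1\<close>, then \<open>p = l - 2\<close>, but all three intervals are empty.\<close>
  have split: "{l..n-1} = {l..p} \<union> {p+1..n-1}"
    using Dn l assms(1,12) by auto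
  \<comment> \<open>The indices other than \<open>n\<close> whose neighbourhoods contain \<open>y\<close> number \<open>D y - 1 \<le> D n - 1\<close>; those
  with degree \<open>1\<close> contribute nothing, and the others gain most if they are \<open>l, \<dots>, p\<close>.\<close>
  have gain: "(\<Sum>i\<in>{i\<in>?A-{n}. y \<in> N i}. log_gain (card (N i))) \<le> K" if "y \<in> N n" for y
  proof -
    have y: "y \<in> ?A" using that by (simp add: N_def)
    let ?T = "{i\<in>?A-{n}. y \<in> N i}"
    have "{i\<in>?A. y \<in> N i} = insert n ?T" using that assms(1) by auto
    then have "D y = Suc (card ?T)"
      using DN[OF y] by simp
    moreover have "D y \<le> D n" using D_mono[of y n] y by simp
    moreover have "card (?T \<inter> {l..n-1}) \<le> card ?T" by (intro card_mono) auto
    ultimately have "card (?T \<inter> {l..n-1}) \<le> D n - 1" by linarith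
    moreover have "log_gain (d j) \<le> log_gain (d i)" if "l \<le> i" "i \<le> j" "j \<le> n - 1" for i j
      using that l d_ge2 d_mono by (intro log_gain_antimono) auto
    ultimately have "(\<Sum>i\<in>?T \<inter> {l..n-1}. log_gain (d i))
        \<le> (\<Sum>i\<in>{l..<l + (D n - 1)} \<inter> {l..n-1}. log_gain (d i))"
      by (intro sum_antimono_le_initial) (auto simp: log_gain_nonneg)
    also have "{l..<l + (D n - 1)} \<inter> {l..n-1} = {l..p}"
      using Dn l assms(1,12) by auto
    also have "(\<Sum>i\<in>?T \<inter> {l..n-1}. log_gain (d i)) = (\<Sum>i\<in>?T. log_gain (d i))"
    proof (rule sum.mono_neutral_left)
      show "\<forall>i\<in>?T - ?T \<inter> {l..n-1}. log_gain (d i) = 0"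
      proof
        fix i assume "i \<in> ?T - ?T \<inter> {l..n-1}"
        then have "d i = 1" by (intro d_eq1) auto
        then show "log_gain (d i) = 0" by (simp add: log_gain_def)
      qed
    qed auto
    finally show ?thesis
      using dN by (simp add: K_def)
  qed
  have "real (card (perfect_matchings V E)) \<le> real (card (bij_selections N ?A ?A))"
    using card_perfect_matchings_le[OF assms(2) _ assms(3)] unfolding N_def by simp
  also have "\<dots> \<le> exp ((\<Sum>i\<in>?A-{n}. ln (fact (card (N i))) / real (card (N i))) + K)"
    using assms(1) gain by (intro card_bij_selections_le) (auto simp: N_def)
  also have "(\<Sum>i\<in>?A-{n}. ln (fact (card (N i))) / real (card (N i)))
      = (\<Sum>i\<in>?A-{n}. ln (fact (d i)) / real (d i))"
    using dN by simp
  also have "\<dots> = (\<Sum>i=l..n-1. ln (fact (d i)) / real (d i))"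
  proof (rule sum.mono_neutral_right)
    show "\<forall>i\<in>?A - {n} - {l..n-1}. ln (fact (d i)) / real (d i) = 0"
    proof
      fix i assume "i \<in> ?A - {n} - {l..n-1}"
      then have "d i = 1" by (intro d_eq1) auto
      then show "ln (fact (d i)) / real (d i) = 0" by simp
    qed
  qed (use l in auto)
  also have "\<dots> = (\<Sum>i=l..p. ln (fact (d i)) / real (d i)) + (\<Sum>i=p+1..n-1. ln (fact (d i)) / real (d i))"
    unfolding split by (rule sum.union_disjoint) auto
  also have "\<dots> + K = (\<Sum>i=l..p. ln (fact (d i)) / (real (d i) - 1)) + (\<Sum>i=p+1..n-1. ln (fact (d i)) / real (d i))"
  proof -
    have "(\<Sum>i=l..p. ln (fact (d i)) / (real (d i) - 1)) = (\<Sum>i=l..p. ln (fact (d i)) / real (d i) + log_gain (d i))"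
      using d_ge2 assms(12) by (intro sum.cong log_gain_split) auto
    then show ?thesis by (simp add: K_def sum.distrib)
  qed
  also have "exp \<dots> = (\<Prod>i=l..p. real (fact (d i)) powr (1 / (real (d i) - 1)))
      * (\<Prod>i=p+1..n-1. real (fact (d i)) powr (1 / real (d i)))"
    by (simp add: exp_add exp_sum powr_def)
  finally show ?thesis .
qed

end
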